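(* Let $G$ be a finite group. Then the members of $\mathcal{Q}(G)$ mutually normalize each other; that is, for all $M,N\in\mathcal{Q}(G)$, $M\leq \operatorname{Norm}_B(N)$ and $N\leq\operatorname{Norm}_B(M)$.
   Context: All groups are finite. For a group $G$, let $B=\operatorname{Perm}(G)$ be the group of all permutations of the set $G$, let $\lambda:G\to B$, $\lambda(g)(h)=gh$, be the left regular representation, and let $\operatorname{Hol}(G)=\operatorname{Norm}_B(\lambda(G))$. A subgroup of $B$ is regular if it acts transitively with trivial point stabilizers. Define $\mathcal{S}(G)=\{N\leq B \mid N\text{ regular},\ N\cong G,\ N\leq\operatorname{Hol}(G)\}$ and $\mathcal{R}(G)=\{N\leq B\mid N\text{ regular},\ N\cong G,\ \lambda(G)\leq\operatorname{Norm}_B(N)\}$. A subgroup $N$ normalizes $M$ if $N\leq\operatorname{Norm}_B(M)$. Define $$\mathcal{Q}(G)=\bigcap_{N\in\mathcal{S}(G)\cap\mathcal{R}(G)}\{M\in\mathcal{S}(G)\cap\mathcal{R}(G)\mid N\text{ normalizes }M\}.$$ *)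

theory Defs
  imports "HOL-Algebra.Algebra"
begin

text \<open>
  The group B = Perm(G) is \<^term>\<open>BijGroup (carrier G)\<close>. Its elements are functions that are
  extensional on \<^term>\<open>carrier G\<close>, hence the restricted abstraction below.
\<close>

definition left_regular :: "('a, 'b) monoid_scheme \<Rightarrow> 'a \<Rightarrow> 'a \<Rightarrow> 'a" where
  "left_regular G g = (\<lambda>h\<in>carrier G. g \<otimes>\<^bsub>G\<^esub> h)"

definition left_regular_image :: "('a, 'b) monoid_scheme \<Rightarrow> ('a \<Rightarrow> 'a) set" where
  "left_regular_image G = left_regular G ` carrier G"

definition Hol :: "('a, 'b) monoid_scheme \<Rightarrow> ('a \<Rightarrow> 'a) set" where
  "Hol G = normalizer (BijGroup (carrier G)) (left_regular_image G)"

definition regular_subgroup :: "('a \<Rightarrow> 'a) set \<Rightarrow> 'a set \<Rightarrow> bool" where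
  "regular_subgroup N E \<longleftrightarrow>
     subgroup N (BijGroup E) \<and>
     transitive_action (BijGroup E\<lparr>carrier := N\<rparr>) E (\<lambda>f. f) \<and>
     (\<forall>x\<in>E. stabilizer (BijGroup E\<lparr>carrier := N\<rparr>) (\<lambda>f. f) x = {\<one>\<^bsub>BijGroup E\<^esub>})"

text \<open>
  For subgroups \<open>N\<close>, \<open>M\<close> of \<open>B\<close>, containment of \<open>N\<close> in the subgroup \<open>normalizer B M\<close> is the same as
  being a subgroup of it, so \<open>\<le>\<close> between subgroups is rendered by \<open>\<subseteq>\<close>.
\<close>

definition normalizes :: "('g, 'b) monoid_scheme \<Rightarrow> 'g set \<Rightarrow> 'g set \<Rightarrow> bool" where
  "normalizes B N M \<longleftrightarrow> N \<subseteq> normalizer B M"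

definition S_set :: "('a, 'b) monoid_scheme \<Rightarrow> ('a \<Rightarrow> 'a) set set" where
  "S_set G = {N. regular_subgroup N (carrier G) \<and>
                 BijGroup (carrier G)\<lparr>carrier := N\<rparr> \<cong> G \<and>
                 N \<subseteq> Hol G}"

definition R_set :: "('a, 'b) monoid_scheme \<Rightarrow> ('a \<Rightarrow> 'a) set set" where
  "R_set G = {N. regular_subgroup N (carrier G) \<and>
                 BijGroup (carrier G)\<lparr>carrier := N\<rparr> \<cong> G \<and>
                 left_regular_image G \<subseteq> normalizer (BijGroup (carrier G)) N}"

text \<open>
  For a group \<open>G\<close> the index set contains \<^term>\<open>left_regular_image G\<close>, so the intersection is never
  the vacuous one (which would be \<^term>\<open>UNIV\<close>).
\<close>

definition Q_set :: "('a, 'b) monoid_scheme \<Rightarrow> ('a \<Rightarrow> 'a) set set" where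
  "Q_set G = (\<Inter>N \<in> S_set G \<inter> R_set G.
                {M \<in> S_set G \<inter> R_set G. normalizes (BijGroup (carrier G)) N M})"

end

theory Submission
  imports Defs
begin

text \<open>
  Membership of \<open>M\<close> in \<open>\<Q>(G)\<close> says that every element of \<open>\<S>(G) \<inter> \<R>(G)\<close> normalizes \<open>M\<close>, so it
  suffices that members of \<open>\<Q>(G)\<close> lie in \<open>\<S>(G) \<inter> \<R>(G)\<close>. This only requires the index set of the
  intersection to be nonempty, and \<open>\<lambda>(G)\<close> belongs to it because a subgroup normalizes itself.
\<close>

lemma (in group) subgroup_subset_normalizer:
  assumes "subgroup H G"
  shows "H \<subseteq> normalizer G H"
proof -
  \<comment> \<open>\<open>H\<close> is normal in its normalizer, so in particular a subset of that
    group's carrier.\<close>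
  interpret N: normal H "G\<lparr>carrier := normalizer G H\<rparr>"
    using assms by (rule subgroup_in_normalizer)
  show ?thesis
    using N.subset by simp
qed

context group
begin

lemma left_regular_Bij:
  assumes "g \<in> carrier G"
  shows "left_regular G g \<in> Bij (carrier G)"
proof -
  have "bij_betw (left_regular G g) (carrier G) (carrier G)"
    by (rule bij_betw_byWitness[where f' = "\<lambda>h. inv g \<otimes> h"])
      (use assms in \<open>auto simp: left_regular_def m_assoc[symmetric]\<close>)
  then show ?thesis
    by (simp add: Bij_def left_regular_def)
qed

text \<open>Associativity gives equality on the carrier; off it both sides are
  \<open>undefined\<close>, since composition in \<open>BijGroup\<close> is restricted too.\<close>

lemma left_regular_hom: "left_regular G \<in> hom G (BijGroup (carrier G))"
proof (rule homI)
  show "left_regular G g \<in> carrier (BijGroup (carrier G))" if "g \<in> carrier G" for g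
    using that by (simp add: BijGroup_def left_regular_Bij)
  show "left_regular G (g \<otimes> h) = left_regular G g \<otimes>\<^bsub>BijGroup (carrier G)\<^esub> left_regular G h"
    if "g \<in> carrier G" "h \<in> carrier G" for g h
    using that left_regular_Bij
    by (auto simp: BijGroup_def compose_def left_regular_def m_assoc fun_eq_iff)
qed

lemma inj_on_left_regular: "inj_on (left_regular G) (carrier G)"
proof (rule inj_onI)
  fix g h
  assume "g \<in> carrier G" "h \<in> carrier G" "left_regular G g = left_regular G h"
  \<comment> \<open>Evaluation at \<one> recovers the translating element.\<close>
  then show "g = h"
    by (auto simp: left_regular_def dest!: fun_cong[where x = \<one>])
qed

lemma subgroup_left_regular_image:
  "subgroup (left_regular_image G) (BijGroup (carrier G))"
proof -
  interpret group_hom G "BijGroup (carrier G)" "left_regular G"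
    by (simp add: group_hom_def group_hom_axioms_def is_group group_BijGroup left_regular_hom)
  show ?thesis
    unfolding left_regular_image_def by (rule img_is_subgroup)
qed

lemma left_regular_image_iso:
  "BijGroup (carrier G)\<lparr>carrier := left_regular_image G\<rparr> \<cong> G"
proof (rule iso_sym, rule is_isoI)
  show "left_regular G \<in> iso G (BijGroup (carrier G)\<lparr>carrier := left_regular_image G\<rparr>)"
    using left_regular_hom inj_on_left_regular
    by (auto simp: iso_def hom_def bij_betw_def left_regular_image_def)
qed

lemma regular_subgroup_left_regular_image:
  "regular_subgroup (left_regular_image G) (carrier G)"
  unfolding regular_subgroup_def
proof (intro conjI ballI)
  let ?B = "BijGroup (carrier G)"
  let ?L = "?B\<lparr>carrier := left_regular_image G\<rparr>"
  interpret B: group ?B by (rule group_BijGroup)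
  interpret L: subgroup "left_regular_image G" ?B by (rule subgroup_left_regular_image)
  show "subgroup (left_regular_image G) ?B" by (rule subgroup_left_regular_image)
  \<comment> \<open>An action is a homomorphism into \<open>?B\<close>; here it is the inclusion of
    the subgroup.\<close>
  have "group_hom ?L ?B (\<lambda>f. f)"
    by (auto simp: group_hom_def group_hom_axioms_def hom_def group_BijGroup
        intro: L.subgroup_is_group)
  moreover have "\<exists>f\<in>carrier ?L. f x = y" if "x \<in> carrier G" "y \<in> carrier G" for x y
    using that
    \<comment> \<open>Left translation by \<open>y \<otimes> inv x\<close> is the one that carries
      \<open>x\<close> to \<open>y\<close>.\<close>
    by (auto simp: left_regular_image_def left_regular_def m_assoc intro!: bexI[of _ "y \<otimes> inv x"])
  ultimately show "transitive_action ?L (carrier G) (\<lambda>f. f)"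
    by (simp add: transitive_action_def group_action_def transitive_action_axioms_def)
  fix x
  assume x: "x \<in> carrier G"
  have "left_regular G g = \<one>\<^bsub>?B\<^esub>" if "g \<in> carrier G" "left_regular G g x = x" for g
  proof -
    \<comment> \<open>Cancel \<open>x\<close> on the right in
      \<open>g \<otimes> x = x\<close>.\<close>
    have "g = \<one>"
      using that x by (simp add: left_regular_def)
    then show ?thesis
      by (auto simp: left_regular_def BijGroup_def)
  qed
  moreover have "\<one>\<^bsub>?B\<^esub> x = x"
    using x by (simp add: BijGroup_def)
  ultimately show "stabilizer ?L (\<lambda>f. f) x = {\<one>\<^bsub>?B\<^esub>}"
    using L.one_closed by (auto simp: stabilizer_def left_regular_image_def)
qed

text \<open>For \<lambda>(G) itself, the normalizing conditions of \<open>S_set\<close> and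
  \<open>R_set\<close> coincide: both say that \<lambda>(G) lies in its own normalizer.\<close>

lemma left_regular_image_in_S_R: "left_regular_image G \<in> S_set G \<inter> R_set G"
  using regular_subgroup_left_regular_image left_regular_image_iso
    group.subgroup_subset_normalizer[OF group_BijGroup subgroup_left_regular_image]
  by (simp add: S_set_def R_set_def Hol_def)

end

theorem lemma4p7:
  fixes G (structure)
  assumes "group G"
    and "finite (carrier G)"
  shows "\<forall>M \<in> Q_set G. \<forall>N \<in> Q_set G.
           M \<subseteq> normalizer (BijGroup (carrier G)) N \<and>
           N \<subseteq> normalizer (BijGroup (carrier G)) M"
proof -
  have "Q_set G \<subseteq> S_set G \<inter> R_set G"
    using group.left_regular_image_in_S_R[OF assms(1)] by (auto simp: Q_set_def)
  then show ?thesis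
    \<comment> \<open>Each of \<open>M\<close> and \<open>N\<close> now serves as an index in the
      intersection that contains the other, which gives the two inclusions.\<close>
    unfolding Q_set_def normalizes_def by blast
qed

end
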